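(* Let $X,Y$ be Polish spaces and let $c:X\times Y\to[0,\infty)$ be a continuous cost function with $c(x,y)\le c_X(x)+c_Y(y)$ for all $(x,y)$, where $c_X:X\to\mathbb{R}$ and $c_Y:Y\to\mathbb{R}$ are fixed measurable functions. Let $\gamma$ be an optimal coupling between $\mu\in\mathscr{P}_c(X)$ and $\nu\in\mathscr{P}_c(Y)$. Then $K^\gamma$ is an optimal transport kernel on $\mathscr{ACP}^b_c(\mu)$, and $\eta K^\gamma\in\mathscr{P}_c(Y)$ for every $\eta\in\mathscr{ACP}^b_c(\mu)$.
   Context: $\mathscr{P}(Z)$ denotes the Borel probability measures on a Polish space $Z$; $\mathscr{P}_c(X)=\{\mu\in\mathscr{P}(X): c_X\in L^1(\mu)\}$ and $\mathscr{P}_c(Y)=\{\nu\in\mathscr{P}(Y): c_Y\in L^1(\nu)\}$. $\mathscr{ACP}^b_c(\mu)$ is the set of $\eta\in\mathscr{P}_c(X)$ that are absolutely continuous with respect to $\mu$ with bounded Radon–Nikodym derivative $\frac{d\eta}{d\mu}$. A coupling of $\mu$ and $\nu$ is a probability measure on $X\times Y$ with marginals $\mu$ and $\nu$; it is optimal if it minimizes $\int c\,d\gamma$ among all couplings of $\mu$ and $\nu$; $C(\mu,\nu)$ denotes the infimum. For a coupling $\gamma$ of $\mu$ and $\nu$, the associated transition kernel $K^\gamma$ is defined on measures $\eta\in\mathscr{ACP}^b_c(\mu)$ by letting $\eta\odot K^\gamma$ be the measure on $X\times Y$ with $d(\eta\odot K^\gamma)(x,y)=\frac{d\eta}{d\mu}(x)\,d\gamma(x,y)$,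 and $\eta K^\gamma:=(\operatorname{proj}_Y)_\#(\eta\odot K^\gamma)$, where $\operatorname{proj}_Y:X\times Y\to Y$ is the projection. $K^\gamma$ being an optimal transport kernel on $\mathscr{ACP}^b_c(\mu)$ means: for every $\eta\in\mathscr{ACP}^b_c(\mu)$, the measure $\eta\odot K^\gamma$ is an optimal coupling between $\eta$ and $\eta K^\gamma$ whenever the transport problem between them has finite cost, i.e. $C(\eta,\eta K^\gamma)<\infty$. *)

theory Defs
  imports "HOL-Probability.Probability"
begin

definition borel_probs :: "'a::topological_space measure set" where
  "borel_probs = {\<mu>. sets \<mu> = sets borel \<and> prob_space \<mu>}"

text \<open>With \<open>w\<close> instantiated to \<open>c\<^sub>X\<close> resp. \<open>c\<^sub>Y\<close> this is $\mathscr{P}_c(X)$ resp. $\mathscr{P}_c(Y)$.\<close>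

definition borel_probs_int :: "('a::topological_space \<Rightarrow> real) \<Rightarrow> 'a measure set" where
  "borel_probs_int w = {\<mu> \<in> borel_probs. integrable \<mu> w}"

text \<open>$\mathscr{ACP}^b_c(\mu)$. A Radon--Nikodym derivative is determined only up to
  \<open>\<mu>\<close>-null sets, so boundedness means essential boundedness.\<close>

definition acp_bounded :: "('a::topological_space \<Rightarrow> real) \<Rightarrow> 'a measure \<Rightarrow> 'a measure set" where
  "acp_bounded w \<mu> = {\<eta> \<in> borel_probs_int w. absolutely_continuous \<mu> \<eta> \<and>
     (\<exists>B::real. AE x in \<mu>. RN_deriv \<mu> \<eta> x \<le> ennreal B)}"

definition couplings ::
  "'a::topological_space measure \<Rightarrow> 'b::topological_space measure \<Rightarrow> ('a \<times> 'b) measure set" where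
  "couplings \<mu> \<nu> = {\<gamma> \<in> borel_probs. distr \<gamma> borel fst = \<mu> \<and> distr \<gamma> borel snd = \<nu>}"

text \<open>Costs are nonnegative, so transport costs are integrals with values in $[0,\infty]$.\<close>

definition transport_cost :: "('a \<times> 'b \<Rightarrow> real) \<Rightarrow> ('a \<times> 'b) measure \<Rightarrow> ennreal" where
  "transport_cost c \<gamma> = (\<integral>\<^sup>+ z. ennreal (c z) \<partial>\<gamma>)"

definition optimal_cost ::
  "('a::topological_space \<times> 'b::topological_space \<Rightarrow> real) \<Rightarrow> 'a measure \<Rightarrow> 'b measure \<Rightarrow> ennreal" where
  "optimal_cost c \<mu> \<nu> = (INF \<gamma>\<in>couplings \<mu> \<nu>. transport_cost c \<gamma>)"

definition optimal_coupling ::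
  "('a::topological_space \<times> 'b::topological_space \<Rightarrow> real) \<Rightarrow> 'a measure \<Rightarrow> 'b measure
     \<Rightarrow> ('a \<times> 'b) measure \<Rightarrow> bool" where
  "optimal_coupling c \<mu> \<nu> \<gamma> \<longleftrightarrow> \<gamma> \<in> couplings \<mu> \<nu> \<and>
     (\<forall>\<gamma>'\<in>couplings \<mu> \<nu>. transport_cost c \<gamma> \<le> transport_cost c \<gamma>')"

text \<open>A kernel \<open>K\<close> is represented by its action \<open>\<eta> \<mapsto> \<eta> \<odot> K\<close> on measures. For $K^\gamma$, with
  \<open>\<gamma>\<close> a coupling whose first marginal is \<open>\<mu>\<close>, this is
  $d(\eta\odot K^\gamma)(x,y) = \frac{d\eta}{d\mu}(x)\,d\gamma(x,y)$.\<close>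

definition coupling_kernel :: "'a measure \<Rightarrow> ('a \<times> 'b) measure \<Rightarrow> 'a measure \<Rightarrow> ('a \<times> 'b) measure" where
  "coupling_kernel \<mu> \<gamma> \<eta> = density \<gamma> (\<lambda>(x, y). RN_deriv \<mu> \<eta> x)"

text \<open>$\eta K = (\mathrm{proj}_Y)_\#(\eta \odot K)$\<close>

definition kernel_image ::
  "('a measure \<Rightarrow> ('a \<times> 'b::topological_space) measure) \<Rightarrow> 'a measure \<Rightarrow> 'b measure" where
  "kernel_image K \<eta> = distr (K \<eta>) borel snd"

definition optimal_transport_kernel_on ::
  "('a::topological_space \<times> 'b::topological_space \<Rightarrow> real) \<Rightarrow> 'a measure set
     \<Rightarrow> ('a measure \<Rightarrow> ('a \<times> 'b) measure) \<Rightarrow> bool" where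
  "optimal_transport_kernel_on c S K \<longleftrightarrow>
     (\<forall>\<eta>\<in>S. optimal_cost c \<eta> (kernel_image K \<eta>) < \<infinity> \<longrightarrow>
        optimal_coupling c \<eta> (kernel_image K \<eta>) (K \<eta>))"

end

theory Submission
  imports Defs
begin

text \<open>Any competitor \<open>\<gamma>'\<close> for the coupling \<open>f \<gamma>\<close>, where \<open>f = d\<eta>/d\<mu> \<le> B\<close>, induces the competitor
  \<open>(1 - f/B) \<gamma> + (1/B) \<gamma>'\<close> for \<open>\<gamma>\<close>: its marginals are again \<open>\<mu>\<close> and \<open>\<nu>\<close>. Comparing its cost
  with that of \<open>\<gamma> = (1 - f/B) \<gamma> + (1/B) f \<gamma>\<close> and cancelling the common finite part shows that
  \<open>f \<gamma>\<close> is no more expensive than \<open>\<gamma>'\<close>.\<close>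

text \<open>For \<open>p\<close> in [0,1] this is the convex combination
  \<open>p M + (1 - p) N\<close>. Drawing the component by a Bernoulli variable and binding makes it
  a probability measure by the general facts on \<open>bind\<close>.\<close>

definition mixture :: "real \<Rightarrow> 'a measure \<Rightarrow> 'a measure \<Rightarrow> 'a measure" where
  "mixture p M N = measure_pmf (bernoulli_pmf p) \<bind> (\<lambda>b. if b then M else N)"

text \<open>The Bernoulli space is discrete, so it suffices that both values are probability
  measures on the same sigma-algebra.\<close>

lemma mixture_kernel_measurable:
  assumes "prob_space M" "prob_space N" "sets N = sets M"
  shows "(\<lambda>b. if b then M else N) \<in> measurable (measure_pmf (bernoulli_pmf p)) (prob_algebra M)"
  using assms by (auto simp: space_prob_algebra)

lemma
  assumes "prob_space M" "prob_space N" "sets N = sets M"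
  shows sets_mixture: "sets (mixture p M N) = sets M"
    and prob_space_mixture: "prob_space (mixture p M N)"
proof -
  show "sets (mixture p M N) = sets M"
    unfolding mixture_def using assms by (intro sets_bind) auto
  show "prob_space (mixture p M N)"
    unfolding mixture_def
    by (rule prob_space_bind'[OF _ mixture_kernel_measurable[OF assms]])
      (simp add: space_prob_algebra prob_space_measure_pmf)
qed

lemma nn_integral_mixture:
  assumes "prob_space M" "prob_space N" "sets N = sets M" "0 \<le> p" "p \<le> 1"
    and f: "f \<in> borel_measurable M"
  shows "(\<integral>\<^sup>+x. f x \<partial>mixture p M N) = ennreal p * (\<integral>\<^sup>+x. f x \<partial>M) + ennreal (1 - p) * (\<integral>\<^sup>+x. f x \<partial>N)"
proof -
  have "(\<integral>\<^sup>+x. f x \<partial>mixture p M N)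
      = (\<integral>\<^sup>+b. (\<integral>\<^sup>+x. f x \<partial>(if b then M else N)) \<partial>measure_pmf (bernoulli_pmf p))"
    unfolding mixture_def
    by (rule nn_integral_bind[OF f measurable_prob_algebraD[OF mixture_kernel_measurable[OF assms(1-3)]]])
  then show ?thesis
    using assms by (simp add: mult.commute)
qed

text \<open>Expressing the marginals through integrals of indicators allows the marginals of a
  mixture to be read off from linearity of the integral.\<close>

lemma couplings_iff_emeasure:
  fixes \<gamma> :: "('a::topological_space \<times> 'b::topological_space) measure"
  assumes "\<gamma> \<in> borel_probs" "sets \<mu> = sets borel" "sets \<nu> = sets borel"
  shows "\<gamma> \<in> couplings \<mu> \<nu> \<longleftrightarrow>
    (\<forall>A\<in>sets borel. (\<integral>\<^sup>+z. indicator A (fst z) \<partial>\<gamma>) = emeasure \<mu> A) \<and>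
    (\<forall>A\<in>sets borel. (\<integral>\<^sup>+z. indicator A (snd z) \<partial>\<gamma>) = emeasure \<nu> A)"
proof -
  have s: "sets \<gamma> = sets borel"
    using assms by (auto simp: borel_probs_def)
  \<comment> \<open>The product carries the Borel sets of the product topology, so the projections
    are measurable by continuity.\<close>
  have m: "fst \<in> borel_measurable \<gamma>" "snd \<in> borel_measurable \<gamma>"
    by (auto simp: measurable_cong_sets[OF s refl] intro!: borel_measurable_continuous_onI continuous_intros)
  \<comment> \<open>The target type \<open>'c\<close> is left general so that one argument serves
    both projections.\<close>
  have eq: "distr \<gamma> borel g = \<rho> \<longleftrightarrow>
      (\<forall>A\<in>sets borel. (\<integral>\<^sup>+z. indicator A (g z) \<partial>\<gamma>) = emeasure \<rho> A)"
    if "sets \<rho> = sets borel" "g \<in> borel_measurable \<gamma>" for \<rho> :: "'c::topological_space measure" and g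
  proof -
    have "(\<integral>\<^sup>+z. indicator A (g z) \<partial>\<gamma>) = emeasure (distr \<gamma> borel g) A" if "A \<in> sets borel" for A
      using that \<open>g \<in> _\<close> by (simp add: nn_integral_distr flip: nn_integral_indicator)
    then show ?thesis
      using that by (auto intro!: measure_eqI)
  qed
  show ?thesis
    using assms eq[OF assms(2) m(1)] eq[OF assms(3) m(2)] by (auto simp: couplings_def)
qed

lemma couplingsD:
  fixes \<gamma> :: "('a::topological_space \<times> 'b::topological_space) measure"
  assumes "\<gamma> \<in> couplings \<mu> \<nu>"
  shows "prob_space \<gamma>" "sets \<gamma> = sets borel"
    "fst \<in> borel_measurable \<gamma>" "snd \<in> borel_measurable \<gamma>"
    "distr \<gamma> borel fst = \<mu>" "distr \<gamma> borel snd = \<nu>"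
proof -
  show s: "sets \<gamma> = sets borel" and "prob_space \<gamma>"
    and "distr \<gamma> borel fst = \<mu>" "distr \<gamma> borel snd = \<nu>"
    using assms by (auto simp: couplings_def borel_probs_def)
  show "fst \<in> borel_measurable \<gamma>" "snd \<in> borel_measurable \<gamma>"
    by (auto simp: measurable_cong_sets[OF s refl] intro!: borel_measurable_continuous_onI continuous_intros)
qed

lemma nn_integral_coupling:
  fixes \<gamma> :: "('a::topological_space \<times> 'b::topological_space) measure"
  assumes \<gamma>: "\<gamma> \<in> couplings \<mu> \<nu>"
  shows "g \<in> borel_measurable borel \<Longrightarrow> (\<integral>\<^sup>+z. g (fst z) \<partial>\<gamma>) = (\<integral>\<^sup>+x. g x \<partial>\<mu>)"
    and "h \<in> borel_measurable borel \<Longrightarrow> (\<integral>\<^sup>+z. h (snd z) \<partial>\<gamma>) = (\<integral>\<^sup>+y. h y \<partial>\<nu>)"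
  using couplingsD(3,4)[OF \<gamma>] unfolding couplingsD(5,6)[OF \<gamma>, symmetric]
  by (simp_all add: nn_integral_distr)

text \<open>The bound on \<open>c\<close> separates the variables, so its integral depends on the
  marginals only. Absolute values are taken because \<open>u\<close> and \<open>v\<close> may be
  negative at some points.\<close>

lemma transport_cost_finite:
  fixes \<gamma> :: "('a::topological_space \<times> 'b::topological_space) measure"
  assumes \<gamma>: "\<gamma> \<in> couplings \<mu> \<nu>"
    and [measurable]: "u \<in> borel_measurable borel" "v \<in> borel_measurable borel"
    and le: "\<And>x y. c (x, y) \<le> u x + v y"
    and int: "integrable \<mu> u" "integrable \<nu> v"
  shows "transport_cost c \<gamma> < \<infinity>"
proof -
  note [measurable] = couplingsD(3,4)[OF \<gamma>]
  have "transport_cost c \<gamma> \<le> (\<integral>\<^sup>+z. ennreal \<bar>u (fst z)\<bar> + ennreal \<bar>v (snd z)\<bar> \<partial>\<gamma>)"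
    unfolding transport_cost_def
  proof (intro nn_integral_mono)
    fix z
    have "c z \<le> \<bar>u (fst z)\<bar> + \<bar>v (snd z)\<bar>"
      using le[of "fst z" "snd z"] by simp
    then show "ennreal (c z) \<le> ennreal \<bar>u (fst z)\<bar> + ennreal \<bar>v (snd z)\<bar>"
      by (simp add: ennreal_leI flip: ennreal_plus)
  qed
  also have "\<dots> = (\<integral>\<^sup>+x. ennreal \<bar>u x\<bar> \<partial>\<mu>) + (\<integral>\<^sup>+y. ennreal \<bar>v y\<bar> \<partial>\<nu>)"
    using nn_integral_coupling(1)[OF \<gamma>, of "\<lambda>x. ennreal \<bar>u x\<bar>"]
      nn_integral_coupling(2)[OF \<gamma>, of "\<lambda>y. ennreal \<bar>v y\<bar>"]
    by (subst nn_integral_add) auto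
  also have "\<dots> < \<infinity>"
    using int by (simp add: integrable_iff_bounded)
  finally show ?thesis .
qed

text \<open>The density depends on the first coordinate alone, hence it passes through the
  projection and turns the first marginal \<mu> into \<eta>. The second marginal is whatever
  results.\<close>

lemma coupling_density:
  fixes \<gamma> :: "('a::topological_space \<times> 'b::topological_space) measure"
  assumes \<gamma>: "\<gamma> \<in> couplings \<mu> \<nu>" and \<eta>: "prob_space \<eta>" "density \<mu> f = \<eta>"
    and f[measurable]: "f \<in> borel_measurable borel"
  shows "density \<gamma> (\<lambda>z. f (fst z)) \<in> couplings \<eta> (distr (density \<gamma> (\<lambda>z. f (fst z))) borel snd)"
proof -
  note [measurable] = couplingsD(3,4)[OF \<gamma>]
  have "distr (density \<gamma> (\<lambda>z. f (fst z))) borel fst = density (distr \<gamma> borel fst) f"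
    by (rule density_distr[symmetric]) measurable
  then have fst: "distr (density \<gamma> (\<lambda>z. f (fst z))) borel fst = \<eta>"
    by (simp only: couplingsD(5)[OF \<gamma>] \<eta>(2))
  \<comment> \<open>Total mass one is inherited from the pushforward \<eta>.\<close>
  have "prob_space (density \<gamma> (\<lambda>z. f (fst z)))"
    by (rule prob_space_distrD[of fst _ borel]) (simp_all only: fst \<eta>(1), measurable)
  then show ?thesis
    using fst couplingsD(2)[OF \<gamma>] by (simp add: couplings_def borel_probs_def)
qed

text \<open>With \<open>F\<close> the measure of density \<open>f\<close> with respect to \<gamma>,
  one has \<gamma> = \<open>(1/B) F + (1 - 1/B) R\<close> for a probability measure
  \<open>R\<close>. Replacing \<open>F\<close> by \<gamma>', which has the same marginals, keeps the
  marginals of the sum. The term \<open>r c\<close> is the contribution of \<open>R\<close>, common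
  to both costs.\<close>

lemma exchange_coupling:
  fixes \<gamma> \<gamma>' :: "('a::topological_space \<times> 'b::topological_space) measure"
  assumes \<gamma>: "\<gamma> \<in> couplings \<mu> \<nu>" and B: "1 < B"
    and f[measurable]: "f \<in> borel_measurable borel"
    and bound: "AE x in \<mu>. f x \<le> ennreal B"
    and \<eta>: "prob_space \<eta>" "density \<mu> f = \<eta>"
    and \<gamma>': "\<gamma>' \<in> couplings \<eta> (distr (density \<gamma> (\<lambda>z. f (fst z))) borel snd)"
  obtains \<gamma>'' r where "\<gamma>'' \<in> couplings \<mu> \<nu>"
    "\<And>c. c \<in> borel_measurable borel \<Longrightarrow>
       transport_cost c \<gamma>'' = ennreal (1/B) * transport_cost c \<gamma>' + r c"
    "\<And>c. c \<in> borel_measurable borel \<Longrightarrow>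
       transport_cost c \<gamma> = ennreal (1/B) * transport_cost c (density \<gamma> (\<lambda>z. f (fst z))) + r c"
proof -
  note \<gamma>s = couplingsD(2)[OF \<gamma>]
  note [measurable] = couplingsD(3,4)[OF \<gamma>]
  define F where "F = density \<gamma> (\<lambda>z. f (fst z))"
  have F: "F \<in> couplings \<eta> (distr F borel snd)"
    unfolding F_def by (rule coupling_density[OF \<gamma> \<eta> f])
  \<comment> \<open>This is \<open>(1 - f/B) / (1 - 1/B)\<close>, the leftover density normalised to
    total mass one; \<open>1 < B\<close> keeps the denominator positive.\<close>
  define h where "h z = (ennreal B - f (fst z)) * ennreal (1 / (B - 1))" for z :: "'a \<times> 'b"
  define R where "R = density \<gamma> h"
  have [measurable]: "h \<in> borel_measurable \<gamma>"
    unfolding h_def by measurable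
  have Rs: "sets R = sets borel" by (simp add: R_def \<gamma>s)
  have bd: "AE z in \<gamma>. f (fst z) \<le> ennreal B"
    using bound unfolding couplingsD(5)[OF \<gamma>, symmetric] by (simp add: AE_distr_iff)
  have split: "(\<integral>\<^sup>+z. g z \<partial>\<gamma>) = ennreal (1/B) * (\<integral>\<^sup>+z. g z \<partial>F) + ennreal (1 - 1/B) * (\<integral>\<^sup>+z. g z \<partial>R)"
    if "g \<in> borel_measurable borel" for g
  proof -
    have [measurable]: "g \<in> borel_measurable \<gamma>"
      using that by (simp add: measurable_cong_sets[OF \<gamma>s refl])
    have "ennreal (1/B) * (\<integral>\<^sup>+z. g z \<partial>F) + ennreal (1 - 1/B) * (\<integral>\<^sup>+z. g z \<partial>R)
        = (\<integral>\<^sup>+z. ennreal (1/B) * (f (fst z) * g z) + ennreal (1 - 1/B) * (h z * g z) \<partial>\<gamma>)"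
      unfolding F_def R_def by (simp add: nn_integral_density nn_integral_add nn_integral_cmult)
    also have "\<dots> = (\<integral>\<^sup>+z. g z \<partial>\<gamma>)"
      using bd
    proof (intro nn_integral_cong_AE, eventually_elim)
      fix z :: "'a \<times> 'b" assume "f (fst z) \<le> ennreal B"
      \<comment> \<open>Subtraction on \<open>ennreal\<close> is truncated; a real representative in
        [0,B] moves the identity to the reals, where it is plain algebra.\<close>
      then obtain a where a: "f (fst z) = ennreal a" "0 \<le> a" "a \<le> B"
        using B by (cases "f (fst z)") (auto simp: top_unique)
      have "ennreal (1/B) * f (fst z) + ennreal (1 - 1/B) * h z
          = ennreal (1/B * a + (1 - 1/B) * ((B - a) * (1 / (B - 1))))"
        unfolding h_def a(1) using a B
        by (simp add: ennreal_minus flip: ennreal_mult ennreal_plus)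
      also have "1/B * a + (1 - 1/B) * ((B - a) * (1 / (B - 1))) = 1"
        using B by (simp add: field_simps)
      finally show "ennreal (1/B) * (f (fst z) * g z) + ennreal (1 - 1/B) * (h z * g z) = g z"
        by (simp flip: mult.assoc distrib_right)
    qed
    finally show ?thesis by simp
  qed
  have R: "prob_space R"
  proof
    \<comment> \<open>Since \<gamma> and \<open>F\<close> have mass one, the decomposition applied
      to the constant 1 forces the mass of \<open>R\<close>; the weight \<open>1 - 1/B\<close> is
      nonzero and can be cancelled.\<close>
    have "1 = ennreal (1/B) + ennreal (1 - 1/B) * emeasure R (space R)"
      using split[of "\<lambda>_. 1"] couplingsD(1)[OF \<gamma>] couplingsD(1)[OF F]
      by (simp add: prob_space.emeasure_space_1)
    also have "1 = ennreal (1/B) + ennreal (1 - 1/B) * 1"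
      using B by (simp flip: ennreal_plus)
    finally have "ennreal (1 - 1/B) * 1 = ennreal (1 - 1/B) * emeasure R (space R)"
      unfolding ennreal_add_left_cancel by simp
    then show "emeasure R (space R) = 1"
      using B unfolding ennreal_mult_cancel_left by auto
  qed
  have \<gamma>'s: "sets \<gamma>' = sets borel" "prob_space \<gamma>'" using couplingsD[OF \<gamma>'] by auto
  \<comment> \<open>The exchange: \<gamma>' takes the place of \<open>F\<close> in the decomposition
    of \<gamma>.\<close>
  define G where "G = mixture (1/B) \<gamma>' R"
  have G: "(\<integral>\<^sup>+z. g z \<partial>G) = ennreal (1/B) * (\<integral>\<^sup>+z. g z \<partial>\<gamma>') + ennreal (1 - 1/B) * (\<integral>\<^sup>+z. g z \<partial>R)"
    if "g \<in> borel_measurable borel" for g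
    unfolding G_def using that \<gamma>'s R Rs B
    by (intro nn_integral_mixture) (auto simp: measurable_cong_sets[OF \<gamma>'s(1) refl])
  have [measurable]: "fst \<in> borel_measurable (borel :: ('a \<times> 'b) measure)"
    "snd \<in> borel_measurable (borel :: ('a \<times> 'b) measure)"
    by (auto intro!: borel_measurable_continuous_onI continuous_intros)
  have same_fst: "(\<integral>\<^sup>+z. indicator A (fst z) \<partial>\<gamma>') = (\<integral>\<^sup>+z. indicator A (fst z) \<partial>F)"
    if "A \<in> sets borel" for A
    using that nn_integral_coupling(1)[OF \<gamma>', of "indicator A"]
      nn_integral_coupling(1)[OF F, of "indicator A"] by simp
  have same_snd: "(\<integral>\<^sup>+z. indicator A (snd z) \<partial>\<gamma>') = (\<integral>\<^sup>+z. indicator A (snd z) \<partial>F)"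
    if "A \<in> sets borel" for A
    using that nn_integral_coupling(2)[OF \<gamma>'[folded F_def], of "indicator A"]
      nn_integral_coupling(2)[OF F, of "indicator A"] by simp
  have "G \<in> borel_probs"
    unfolding G_def borel_probs_def using \<gamma>'s R Rs by (simp add: sets_mixture prob_space_mixture)
  moreover have "sets \<mu> = sets borel" "sets \<nu> = sets borel"
    using couplingsD(5,6)[OF \<gamma>] by auto
  moreover have "(\<integral>\<^sup>+z. indicator A (fst z) \<partial>G) = emeasure \<mu> A"
    if [measurable]: "A \<in> sets borel" for A
    using split[of "\<lambda>z. indicator A (fst z)"] G[of "\<lambda>z. indicator A (fst z)"] same_fst[of A]
      nn_integral_coupling(1)[OF \<gamma>, of "indicator A"] \<open>sets \<mu> = sets borel\<close> by simp
  moreover have "(\<integral>\<^sup>+z. indicator A (snd z) \<partial>G) = emeasure \<nu> A"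
    if [measurable]: "A \<in> sets borel" for A
    using split[of "\<lambda>z. indicator A (snd z)"] G[of "\<lambda>z. indicator A (snd z)"] same_snd[of A]
      nn_integral_coupling(2)[OF \<gamma>, of "indicator A"] \<open>sets \<nu> = sets borel\<close> by simp
  ultimately have "G \<in> couplings \<mu> \<nu>"
    by (simp add: couplings_iff_emeasure)
  then show ?thesis
    by (rule that[of _ "\<lambda>c. ennreal (1 - 1/B) * (\<integral>\<^sup>+z. ennreal (c z) \<partial>R)"])
      (simp_all add: transport_cost_def G split flip: F_def)
qed

theorem theorem4p4:
  fixes c :: "'a::polish_space \<times> 'b::polish_space \<Rightarrow> real"
    and c\<^sub>X :: "'a \<Rightarrow> real" and c\<^sub>Y :: "'b \<Rightarrow> real"
    and \<mu> :: "'a measure" and \<nu> :: "'b measure" and \<gamma> :: "('a \<times> 'b) measure"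
  assumes "continuous_on UNIV c"
    and "\<And>x y. 0 \<le> c (x, y)"
    and "c\<^sub>X \<in> borel_measurable borel"
    and "c\<^sub>Y \<in> borel_measurable borel"
    and "\<And>x y. c (x, y) \<le> c\<^sub>X x + c\<^sub>Y y"
    and "\<mu> \<in> borel_probs_int c\<^sub>X"
    and "\<nu> \<in> borel_probs_int c\<^sub>Y"
    and "optimal_coupling c \<mu> \<nu> \<gamma>"
  shows "optimal_transport_kernel_on c (acp_bounded c\<^sub>X \<mu>) (coupling_kernel \<mu> \<gamma>) \<and>
    (\<forall>\<eta>\<in>acp_bounded c\<^sub>X \<mu>. kernel_image (coupling_kernel \<mu> \<gamma>) \<eta> \<in> borel_probs_int c\<^sub>Y)"
proof -
  have \<gamma>: "\<gamma> \<in> couplings \<mu> \<nu>"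
    and opt: "\<And>\<gamma>'. \<gamma>' \<in> couplings \<mu> \<nu> \<Longrightarrow> transport_cost c \<gamma> \<le> transport_cost c \<gamma>'"
    using assms(8) by (auto simp: optimal_coupling_def)
  have \<mu>: "prob_space \<mu>" "sets \<mu> = sets borel" "integrable \<mu> c\<^sub>X"
    and \<nu>: "integrable \<nu> c\<^sub>Y"
    using assms(6,7) by (auto simp: borel_probs_int_def borel_probs_def)
  interpret \<mu>: prob_space \<mu> by fact
  have c: "c \<in> borel_measurable borel"
    using assms(1) by (rule borel_measurable_continuous_onI)
  \<comment> \<open>Finiteness is what later permits cancelling the common part of two
    costs.\<close>
  have fin: "transport_cost c \<gamma> < \<infinity>"
    using \<gamma> assms(3-5) \<mu>(3) \<nu> by (rule transport_cost_finite)
  have "optimal_coupling c \<eta> (kernel_image (coupling_kernel \<mu> \<gamma>) \<eta>) (coupling_kernel \<mu> \<gamma> \<eta>) \<and>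
      kernel_image (coupling_kernel \<mu> \<gamma>) \<eta> \<in> borel_probs_int c\<^sub>Y"
    if acp: "\<eta> \<in> acp_bounded c\<^sub>X \<mu>" for \<eta>
  proof -
    define f where "f = RN_deriv \<mu> \<eta>"
    have \<eta>: "prob_space \<eta>" "sets \<eta> = sets \<mu>" "absolutely_continuous \<mu> \<eta>"
      using acp \<mu>(2) by (auto simp: acp_bounded_def borel_probs_int_def borel_probs_def)
    obtain B0 where "AE x in \<mu>. f x \<le> ennreal B0"
      using acp by (auto simp: acp_bounded_def f_def)
    \<comment> \<open>The essential bound may be at most 1; enlarging it to at least 2 makes
      \<open>1 - 1/B\<close> positive, as the exchange requires.\<close>
    moreover define B where "B = max B0 2"
    ultimately have bound: "AE x in \<mu>. f x \<le> ennreal B"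
      by (auto elim!: eventually_mono intro: order_trans ennreal_leI)
    have B: "1 < B" by (simp add: B_def)
    have f[measurable]: "f \<in> borel_measurable borel"
      unfolding f_def measurable_cong_sets[OF \<mu>(2)[symmetric] refl] by simp
    have dens: "density \<mu> f = \<eta>"
      unfolding f_def using \<eta> by (intro \<mu>.density_RN_deriv) auto
    define F where "F = density \<gamma> (\<lambda>z. f (fst z))"
    have K: "coupling_kernel \<mu> \<gamma> \<eta> = F"
      by (simp add: coupling_kernel_def F_def f_def case_prod_beta')
    have F: "F \<in> couplings \<eta> (distr F borel snd)"
      unfolding F_def by (rule coupling_density[OF \<gamma> \<eta>(1) dens f])
    have "transport_cost c F \<le> transport_cost c \<gamma>'" if \<gamma>': "\<gamma>' \<in> couplings \<eta> (distr F borel snd)" for \<gamma>'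
    proof -
      obtain \<gamma>'' r where G: "\<gamma>'' \<in> couplings \<mu> \<nu>"
        "transport_cost c \<gamma>'' = ennreal (1/B) * transport_cost c \<gamma>' + r c"
        "transport_cost c \<gamma> = ennreal (1/B) * transport_cost c F + r c"
        using exchange_coupling[OF \<gamma> B f bound \<eta>(1) dens \<gamma>'[unfolded F_def]] c unfolding F_def by metis
      \<comment> \<open>Optimality of \<gamma> against the exchanged coupling \<gamma>'', with both
        costs decomposed.\<close>
      then have "ennreal (1/B) * transport_cost c F + r c \<le> ennreal (1/B) * transport_cost c \<gamma>' + r c"
        using opt by metis
      \<comment> \<open>\<open>r c\<close> is a summand of the finite cost of \<gamma>; an infinite
        summand could not be cancelled.\<close>
      moreover have "r c \<noteq> \<infinity>"
        using fin G(3) by auto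
      ultimately have "ennreal (1/B) * transport_cost c F \<le> ennreal (1/B) * transport_cost c \<gamma>'"
        by (simp add: add.commute[of _ "r c"] ennreal_add_left_cancel_le)
      then show ?thesis
        using B by (simp add: ennreal_mult_le_mult_iff)
    qed
    then have "optimal_coupling c \<eta> (distr F borel snd) F"
      using F by (simp add: optimal_coupling_def)
    \<comment> \<open>As \<open>f\<close> is at most \<open>B\<close> almost everywhere,
      \<open>F\<close> is dominated by \<open>B\<close> times \<gamma>, so its second marginal is
      dominated by \<open>B\<close> times \<nu>, for which \<open>c\<^sub>Y\<close> is
      integrable.\<close>
    moreover have "integrable (distr F borel snd) c\<^sub>Y"
    proof -
      note [measurable] = couplingsD(3,4)[OF \<gamma>] couplingsD(4)[OF F] assms(4)
      have bd: "AE z in \<gamma>. f (fst z) \<le> ennreal B"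
        using bound unfolding couplingsD(5)[OF \<gamma>, symmetric] by (simp add: AE_distr_iff)
      have "(\<integral>\<^sup>+y. ennreal \<bar>c\<^sub>Y y\<bar> \<partial>distr F borel snd) = (\<integral>\<^sup>+z. f (fst z) * ennreal \<bar>c\<^sub>Y (snd z)\<bar> \<partial>\<gamma>)"
        by (simp add: nn_integral_distr) (simp add: F_def nn_integral_density)
      also have "\<dots> \<le> (\<integral>\<^sup>+z. ennreal B * ennreal \<bar>c\<^sub>Y (snd z)\<bar> \<partial>\<gamma>)"
        using bd by (intro nn_integral_mono_AE) (auto elim!: eventually_mono intro: mult_right_mono)
      also have "\<dots> = ennreal B * (\<integral>\<^sup>+y. ennreal \<bar>c\<^sub>Y y\<bar> \<partial>\<nu>)"
        using nn_integral_coupling(2)[OF \<gamma>, of "\<lambda>y. ennreal \<bar>c\<^sub>Y y\<bar>"]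
        by (simp add: nn_integral_cmult)
      also have "\<dots> < \<infinity>"
        using \<nu> by (simp add: integrable_iff_bounded ennreal_mult_less_top)
      finally show ?thesis
        by (simp add: integrable_iff_bounded)
    qed
    moreover have "prob_space (distr F borel snd)"
      using couplingsD(1,4)[OF F] by (rule prob_space.prob_space_distr)
    ultimately show ?thesis
      by (simp add: kernel_image_def K borel_probs_int_def borel_probs_def)
  qed
  then show ?thesis
    by (auto simp: optimal_transport_kernel_on_def)
qed

end
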